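(* Let $k\ge3$ and let $\mathscr{T}\in\mathbb{R}^{n_1\times n_2\times\cdots\times n_k}$ be a tensor in the TTD format with core tensors $\mathscr{G}_t\in\mathbb{R}^{r_{t-1}\times n_t\times r_t}$, $t=1,\dots,k$. Define $\widetilde{\mathscr{G}}_t=\mathscr{G}_t\times_2\mathbf{F}_{n_t}$ for $t=3,\dots,k$, and let $\mathbf{G}_1=\mathbf{Q}_1\mathbf{R}_1$ and $\mathbf{G}_2=\mathbf{Q}_2\mathbf{R}_2$ be the (thin) QR factorizations of the matricization $\mathbf{G}_1\in\mathbb{R}^{n_1\times r_1}$ of $\mathscr{G}_1$ and the mode-2 matricization $\mathbf{G}_2\in\mathbb{R}^{n_2\times r_1r_2}$ of $\mathscr{G}_2$, where $\mathbf{Q}_1\in\mathbb{R}^{n_1\times r_1}$ (so $r_1\le n_1$) and $\mathbf{Q}_2\in\mathbb{R}^{n_2\times q}$, $q=\min\{n_2,r_1r_2\}$, have orthonormal columns. For each frequency tuple $\boldsymbol\beta=(\beta_3,\dots,\beta_k)$, $\beta_t=1,\dots,n_t$, let $$\mathbf{B}_{\boldsymbol\beta}(\alpha_1,\eta)=\sum_{\alpha_2=1}^{r_2}\sum_{\alpha_3=1}^{r_3}\cdots\sum_{\alpha_k=1}^{r_k}\mathbf{R}_2(\eta,\alpha_1+(\alpha_2-1)r_1)\prod_{t=3}^k\widetilde{\mathscr{G}}_t(\alpha_{t-1},\beta_t,\alpha_t),$$ $\mathbf{M}_{\boldsymbol\beta}=\mathbf{R}_1\mathbf{B}_{\boldsymbol\beta}$,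 $s=\max_{\boldsymbol\beta}\operatorname{rank}(\mathbf{M}_{\boldsymbol\beta})$, and let $\mathbf{M}_{\boldsymbol\beta}=\mathbf{U}_{\boldsymbol\beta}\boldsymbol{S}_{\boldsymbol\beta}(\mathbf{V}_{\boldsymbol\beta})^*$ be the compact SVD padded with zero singular values (and orthonormal columns) to size $s$ if necessary, so that $\mathbf{U}_{\boldsymbol\beta}\in\mathbb{C}^{r_1\times s}$ and $\mathbf{V}_{\boldsymbol\beta}\in\mathbb{C}^{q\times s}$ have orthonormal columns and $\boldsymbol{S}_{\boldsymbol\beta}\in\mathbb{R}^{s\times s}$ is diagonal with nonnegative entries. Let $\rho_t=\beta_t+(\rho_{t+1}-1)n_t$ denote the combined frequency index for $t=k,k-1,\dots,3$, with $\rho_{k+1}=1$. Let $\mathscr{U}$ ($n_1\times s\times n_3\times\cdots\times n_k$), $\mathscr{S}$ ($s\times s\times n_3\times\cdots\times n_k$), $\mathscr{V}$ ($n_2\times s\times n_3\times\cdots\times n_k$) be the tensors given in TTD format by the core tensors $$\mathscr{U}:\ \mathscr{P}_1(1,j_1,\alpha)=\mathbf{Q}_1(j_1,\alpha),\ \ \mathscr{P}_2(\alpha,\xi,\rho_3)=\mathbf{U}_{\boldsymbol\beta}(\alpha,\xi),\ \ \mathscr{P}_t(\rho_t,j_t,\rho_{t+1})=\mathbf{F}_{n_t}^{-1}(j_t,\beta_t),$$ $$\mathscr{S}:\ \mathscr{Q}_1(1,\xi,\mu)=\mathbf{I}_s(\xi,\mu),\ \ \mathscr{Q}_2(\mu,\zeta,\rho_3)=\boldsymbol{S}_{\boldsymbol\beta}(\mu,\zeta),\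 \ \mathscr{Q}_t(\rho_t,j_t,\rho_{t+1})=\mathbf{F}_{n_t}^{-1}(j_t,\beta_t),$$ $$\mathscr{V}:\ \mathscr{R}_1(1,j_2,\eta)=\mathbf{Q}_2(j_2,\eta),\ \ \mathscr{R}_2(\eta,\zeta,\rho_3)=\mathbf{V}_{\boldsymbol\beta}(\eta,\zeta),\ \ \mathscr{R}_t(\rho_t,j_t,\rho_{t+1})=\mathbf{F}_{n_t}^{-1}(j_t,\beta_t),$$ for $t=3,\dots,k$, $\alpha=1,\dots,r_1$, $\eta=1,\dots,q$, $\xi,\zeta,\mu=1,\dots,s$, where all unspecified entries of the transform-mode cores ($t\ge3$) are zero. Then $\mathscr{U},\mathscr{S},\mathscr{V}$ are the factor tensors of a (compact) higher-order SVD of $\mathscr{T}$: $\mathscr{T}=\mathscr{U}\star_H\mathscr{S}\star_H\mathscr{V}^\top$, and for every $\boldsymbol\beta$ the Fourier-domain faces $\widetilde{\mathscr{U}}(:,:,\boldsymbol\beta)$ and $\widetilde{\mathscr{V}}(:,:,\boldsymbol\beta)$ have orthonormal columns and $\widetilde{\mathscr{S}}(:,:,\boldsymbol\beta)$ is diagonal with nonnegative entries.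
   Context: A $k$th-order tensor $\mathscr{X}$ of size $m_1\times\cdots\times m_k$ is in tensor train (TTD) format with (real or complex) cores $\mathscr{C}_t$ of size $\rho'_{t-1}\times m_t\times\rho'_t$, $\rho'_0=\rho'_k=1$, if $\mathscr{X}(j_1,\dots,j_k)=\sum_{\alpha_0,\dots,\alpha_k}\mathscr{C}_1(\alpha_0,j_1,\alpha_1)\cdots\mathscr{C}_k(\alpha_{k-1},j_k,\alpha_k)$, $\alpha_t=1,\dots,\rho'_t$. Here $r_0=r_k=1$. The matricizations are $\mathbf{G}_1(j_1,\alpha_1)=\mathscr{G}_1(1,j_1,\alpha_1)$ and $\mathbf{G}_2(j_2,\alpha_1+(\alpha_2-1)r_1)=\mathscr{G}_2(\alpha_1,j_2,\alpha_2)$. The index $\rho_t$ ranges over $1,\dots,n_tn_{t+1}\cdots n_k$, and $\rho_3$ determines $\boldsymbol\beta$ uniquely; the entry $\mathscr{P}_t(\rho_t,j_t,\rho_{t+1})$ is specified exactly when $\rho_t=\beta_t+(\rho_{t+1}-1)n_t$ for some $\beta_t\in\{1,\dots,n_t\}$. Mode-$p$ multiplication: $(\mathscr{X}\times_p\mathbf{A})(\dots,i,\dots)=\sum_{j_p}\mathbf{A}(i,j_p)\mathscr{X}(\dots,j_p,\dots)$. $\mathbf{F}_n\in\mathbb{C}^{n\times n}$ is the discrete Fourier transform matrix $\mathbf{F}_n(p,q)=\frac{1}{\sqrt n}\omega^{(p-1)(q-1)}$, $\omega=\exp(-2\pi i/n)$. For any tensor $\mathscr{X}$ with modes $3,\dots,k$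 of sizes $n_3,\dots,n_k$, $\widetilde{\mathscr{X}}=\mathscr{X}\times_3\mathbf{F}_{n_3}\times_4\cdots\times_k\mathbf{F}_{n_k}$. Facewise product: $(\mathscr{A}\,\Delta\,\mathscr{B})(:,:,j_3,\dots,j_k)=\mathscr{A}(:,:,j_3,\dots,j_k)\mathscr{B}(:,:,j_3,\dots,j_k)$. Higher-order tensor-tensor product: $\mathscr{A}\star_H\mathscr{B}=(\widetilde{\mathscr{A}}\,\Delta\,\widetilde{\mathscr{B}})\times_3\mathbf{F}_{n_3}^{-1}\times_4\cdots\times_k\mathbf{F}_{n_k}^{-1}$. The transpose $\mathscr{V}^\top$ is the tensor whose Fourier-domain faces are the conjugate transposes $\widetilde{\mathscr{V}}(:,:,\boldsymbol\beta)^*$ of those of $\mathscr{V}$. *)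

theory Defs
  imports
    Complex_Main
    "HOL-Library.FuncSet"
    "HOL-Library.Nonpos_Ints"
    "Jordan_Normal_Form.Schur_Decomposition"
    "Jordan_Normal_Form.Gauss_Jordan_Elimination"
    "Jordan_Normal_Form.DL_Rank"
begin

text \<open>
  Modes and core numbers t are counted from 1, as usual for tensors. All entry indices (of
  tensors, cores and matrices) are counted from 0, as in \<open>Jordan_Normal_Form.Matrix\<close>; the
  1-based index \<open>a + (b - 1) * m\<close> therefore becomes \<open>a + b * m\<close>.

  A multi-index is a function from modes to entry indices. A tensor is represented by its entry
  function; sizes are passed separately, and only the entries at indices within the sizes matter.
\<close>

type_synonym index = "nat \<Rightarrow> nat"
type_synonym 'a tensor = "index \<Rightarrow> 'a"

text \<open>\<open>C t a j b\<close> is the entry (a, j, b) of the t-th core.\<close>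
type_synonym 'a cores = "nat \<Rightarrow> nat \<Rightarrow> nat \<Rightarrow> nat \<Rightarrow> 'a"

definition indices :: "nat \<Rightarrow> (nat \<Rightarrow> nat) \<Rightarrow> index set" where
  "indices k n = (\<Pi>\<^sub>E t\<in>{1..k}. {..<n t})"

text \<open>Frequency tuples, indexed by the modes 3, ..., k.\<close>
definition freqs :: "nat \<Rightarrow> (nat \<Rightarrow> nat) \<Rightarrow> index set" where
  "freqs k n = (\<Pi>\<^sub>E t\<in>{3..k}. {..<n t})"

definition ttd :: "nat \<Rightarrow> (nat \<Rightarrow> nat) \<Rightarrow> 'a::comm_semiring_1 cores \<Rightarrow> 'a tensor" where
  "ttd k \<rho> C = (\<lambda>j. \<Sum>\<alpha>\<in>(\<Pi>\<^sub>E t\<in>{0..k}. {..<\<rho> t}). \<Prod>t=1..k. C t (\<alpha> (t - 1)) (j t) (\<alpha> t))"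

section \<open>Matrices\<close>

definition mat_rank :: "'a::field mat \<Rightarrow> nat" where
  "mat_rank A = vec_space.rank (dim_row A) A"

definition orthonormal_cols :: "'a::conjugatable_field mat \<Rightarrow> bool" where
  "orthonormal_cols A \<longleftrightarrow>
     (\<forall>i<dim_col A. \<forall>j<dim_col A. col A i \<bullet>c col A j = (if i = j then 1 else 0))"

definition thin_qr :: "real mat \<Rightarrow> real mat \<Rightarrow> real mat \<Rightarrow> bool" where
  "thin_qr A Q R \<longleftrightarrow>
     (let q = min (dim_row A) (dim_col A) in
        Q \<in> carrier_mat (dim_row A) q \<and> R \<in> carrier_mat q (dim_col A) \<and>
        orthonormal_cols Q \<and> upper_triangular R \<and> A = Q * R)"

text \<open>No ordering of the positive singular values is imposed.\<close>
definition padded_compact_svd ::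
  "nat \<Rightarrow> complex mat \<Rightarrow> complex mat \<Rightarrow> real mat \<Rightarrow> complex mat \<Rightarrow> bool" where
  "padded_compact_svd s M U S V \<longleftrightarrow>
     U \<in> carrier_mat (dim_row M) s \<and> S \<in> carrier_mat s s \<and> V \<in> carrier_mat (dim_col M) s \<and>
     orthonormal_cols U \<and> orthonormal_cols V \<and> diagonal_mat S \<and>
     (\<forall>i<s. if i < mat_rank M then S $$ (i,i) > 0 else S $$ (i,i) = 0) \<and>
     M = U * map_mat complex_of_real S * mat_adjoint V"

definition dft :: "nat \<Rightarrow> complex mat" where
  "dft n = mat n n (\<lambda>(p,q).
     exp (- (2 * complex_of_real pi * \<i> / of_nat n)) ^ (p * q) / complex_of_real (sqrt (real n)))"

text \<open>\<^const>\<open>mat_inverse\<close> returns \<^const>\<open>None\<close> only for singular matrices.\<close>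
definition inv_dft :: "nat \<Rightarrow> complex mat" where
  "inv_dft n = the (mat_inverse (dft n))"

section \<open>The higher-order tensor-tensor product\<close>

definition mode_mult :: "nat \<Rightarrow> 'a::comm_semiring_1 mat \<Rightarrow> 'a tensor \<Rightarrow> 'a tensor" where
  "mode_mult p A X = (\<lambda>j. \<Sum>i<dim_col A. A $$ (j p, i) * X (j(p := i)))"

definition fourier :: "nat \<Rightarrow> (nat \<Rightarrow> nat) \<Rightarrow> complex tensor \<Rightarrow> complex tensor" where
  "fourier k n X = fold (\<lambda>t. mode_mult t (dft (n t))) [3..<Suc k] X"

definition inv_fourier :: "nat \<Rightarrow> (nat \<Rightarrow> nat) \<Rightarrow> complex tensor \<Rightarrow> complex tensor" where
  "inv_fourier k n X = fold (\<lambda>t. mode_mult t (inv_dft (n t))) [3..<Suc k] X"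

text \<open>The m by p matrix X(:,:,\<open>\<beta>\<close>).\<close>
definition face :: "nat \<Rightarrow> nat \<Rightarrow> 'a tensor \<Rightarrow> index \<Rightarrow> 'a mat" where
  "face m p X \<beta> = mat m p (\<lambda>(a,b). X (\<beta>(1 := a, 2 := b)))"

text \<open>In \<open>facewise\<close> and \<open>hprod\<close>, \<open>l\<close> is the common size of mode 2 of A and mode 1 of B.\<close>
definition facewise :: "nat \<Rightarrow> 'a::comm_semiring_1 tensor \<Rightarrow> 'a tensor \<Rightarrow> 'a tensor" where
  "facewise l A B = (\<lambda>j. \<Sum>c<l. A (j(2 := c)) * B (j(1 := c)))"

definition hprod ::
  "nat \<Rightarrow> (nat \<Rightarrow> nat) \<Rightarrow> nat \<Rightarrow> complex tensor \<Rightarrow> complex tensor \<Rightarrow> complex tensor" where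
  "hprod k n l A B = inv_fourier k n (facewise l (fourier k n A) (fourier k n B))"

definition htranspose :: "nat \<Rightarrow> (nat \<Rightarrow> nat) \<Rightarrow> complex tensor \<Rightarrow> complex tensor" where
  "htranspose k n X = inv_fourier k n (\<lambda>j. cnj (fourier k n X (j(1 := j 2, 2 := j 1))))"

section \<open>Construction from a tensor train\<close>

definition matricize1 :: "(nat \<Rightarrow> nat) \<Rightarrow> (nat \<Rightarrow> nat) \<Rightarrow> real cores \<Rightarrow> real mat" where
  "matricize1 n r G = mat (n 1) (r 1) (\<lambda>(j,\<alpha>). G 1 0 j \<alpha>)"

text \<open>Column \<open>c = \<alpha>\<^sub>1 + \<alpha>\<^sub>2 * r\<^sub>1\<close> encodes \<open>\<alpha>\<^sub>1 = c mod r\<^sub>1\<close> and \<open>\<alpha>\<^sub>2 = c div r\<^sub>1\<close>.\<close>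
definition matricize2 :: "(nat \<Rightarrow> nat) \<Rightarrow> (nat \<Rightarrow> nat) \<Rightarrow> real cores \<Rightarrow> real mat" where
  "matricize2 n r G = mat (n 2) (r 1 * r 2) (\<lambda>(j,c). G 2 (c mod r 1) j (c div r 1))"

text \<open>The cores multiplied in mode 2 by the Fourier matrix.\<close>
definition fourier_cores :: "(nat \<Rightarrow> nat) \<Rightarrow> real cores \<Rightarrow> complex cores" where
  "fourier_cores n G = (\<lambda>t a i b. \<Sum>j<n t. dft (n t) $$ (i, j) * complex_of_real (G t a j b))"

definition B_mat ::
  "nat \<Rightarrow> (nat \<Rightarrow> nat) \<Rightarrow> (nat \<Rightarrow> nat) \<Rightarrow> real cores \<Rightarrow> real mat \<Rightarrow> index \<Rightarrow> complex mat" where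
  "B_mat k n r G R2 \<beta> = mat (r 1) (dim_row R2) (\<lambda>(\<alpha>1,\<eta>).
     \<Sum>\<alpha>\<in>(\<Pi>\<^sub>E t\<in>{2..k}. {..<r t}).
       complex_of_real (R2 $$ (\<eta>, \<alpha>1 + \<alpha> 2 * r 1)) *
       (\<Prod>t=3..k. fourier_cores n G t (\<alpha> (t - 1)) (\<beta> t) (\<alpha> t)))"

definition M_mat ::
  "nat \<Rightarrow> (nat \<Rightarrow> nat) \<Rightarrow> (nat \<Rightarrow> nat) \<Rightarrow> real cores \<Rightarrow> real mat \<Rightarrow> real mat \<Rightarrow> index \<Rightarrow> complex mat"
  where
  "M_mat k n r G R1 R2 \<beta> = map_mat complex_of_real R1 * B_mat k n r G R2 \<beta>"

text \<open>The combined frequency index \<open>\<rho>\<^sub>t\<close>.\<close>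
function comb_index :: "nat \<Rightarrow> (nat \<Rightarrow> nat) \<Rightarrow> index \<Rightarrow> nat \<Rightarrow> nat" where
  "comb_index k n \<beta> t = (if t \<le> k then \<beta> t + comb_index k n \<beta> (Suc t) * n t else 0)"
  by auto
termination
  by (relation "measure (\<lambda>(k, n, \<beta>, t). Suc k - t)") auto

declare comb_index.simps [simp del]

text \<open>The unique frequency tuple with a given \<open>\<rho>\<^sub>3\<close>.\<close>
definition freq_of :: "nat \<Rightarrow> (nat \<Rightarrow> nat) \<Rightarrow> nat \<Rightarrow> index" where
  "freq_of k n = inv_into (freqs k n) (\<lambda>\<beta>. comb_index k n \<beta> 3)"

text \<open>
  The three factor tensors have cores of a common shape: core 1 is a matrix W, core 2 is a family
  of matrices \<open>Z \<beta>\<close> stacked along \<open>\<rho>\<^sub>3\<close>, and the cores t \<open>\<ge>\<close> 3 are the transform-mode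
  cores. At most one term of the sum below is selected by its condition, so an entry (a, j, b) is
  \<open>inv_dft (n t) $$ (j, \<beta>\<^sub>t)\<close> if \<open>a = \<beta>\<^sub>t + b * n t\<close> for some \<open>\<beta>\<^sub>t < n t\<close>, and 0 otherwise.
\<close>
definition factor_cores ::
  "nat \<Rightarrow> (nat \<Rightarrow> nat) \<Rightarrow> complex mat \<Rightarrow> (index \<Rightarrow> complex mat) \<Rightarrow> complex cores" where
  "factor_cores k n W Z = (\<lambda>t a j b.
     if t = 1 then W $$ (j, b)
     else if t = 2 then Z (freq_of k n b) $$ (a, j)
     else (\<Sum>\<beta>t<n t. if a = \<beta>t + b * n t then inv_dft (n t) $$ (j, \<beta>t) else 0))"

definition factor_ranks :: "nat \<Rightarrow> (nat \<Rightarrow> nat) \<Rightarrow> nat \<Rightarrow> nat \<Rightarrow> nat" where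
  "factor_ranks k n p = (\<lambda>t. if t = 0 then 1 else if t = 1 then p else \<Prod>u=Suc t..k. n u)"

definition factor_tensor ::
  "nat \<Rightarrow> (nat \<Rightarrow> nat) \<Rightarrow> complex mat \<Rightarrow> (index \<Rightarrow> complex mat) \<Rightarrow> complex tensor" where
  "factor_tensor k n W Z = ttd k (factor_ranks k n (dim_col W)) (factor_cores k n W Z)"

end

theory Submission
  imports Defs
begin

text \<open>
  Mode multiplications in distinct modes act independently, so the Fourier transform over the modes
  3, ..., k is one finite sum over frequency tuples with a product kernel
  (\<open>fold_mode_mult\<close>). It is inverted by the transform with the inverse matrices
  (\<open>multi_sum_inverse\<close>). Hence a tensor is determined by its Fourier-domain faces
  (\<open>tensor_eqI_fourier_faces\<close>), and on faces \<open>\<star>\<^sub>H\<close> is the matrix product and the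
  tensor transpose is the conjugate transpose. Everything therefore reduces to the computation of
  the faces at a fixed frequency tuple \<open>\<beta>\<close>.

  For a tensor in tensor train format the transform can be pulled into the cores, because each
  mode index occurs in one core only. Splitting core 2 by its QR factorization then gives
  \<open>Q\<^sub>1 R\<^sub>1 B\<^sub>\<beta> Q\<^sub>2\<^sup>T\<close> as the face of \<open>T\<close> (\<open>face_fourier_ttd\<close>).

  For the factor tensors, the combined index is the mixed-radix number with digits
  \<open>\<beta>\<^sub>3, ..., \<beta>\<^sub>k\<close>. The transform-mode cores vanish unless each auxiliary
  index is its predecessor with the lowest digit removed, so once the digits are chosen only one
  chain of auxiliary indices contributes (\<open>sum_comb_index_chain\<close>). What remains of the tensor
  train is precisely an inverse Fourier transform, so its face at \<open>\<beta>\<close> is the first core times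
  the matrix stored in the second core for \<open>\<beta>\<close> (\<open>face_fourier_factor_tensor\<close>). The
  three faces are thus \<open>Q\<^sub>1 U\<^sub>\<beta>\<close>, \<open>S\<^sub>\<beta>\<close> and \<open>Q\<^sub>2 V\<^sub>\<beta>\<close>.

  Products of matrices with orthonormal columns have orthonormal columns. Finally
  \<open>Q\<^sub>1 M\<^sub>\<beta> Q\<^sub>2\<^sup>T = (Q\<^sub>1 U\<^sub>\<beta>) S\<^sub>\<beta> (Q\<^sub>2 V\<^sub>\<beta>)\<^sup>*\<close>, since \<open>Q\<^sub>2\<close> is real and so its
  transpose is its adjoint.
\<close>

section \<open>Transforms in several modes\<close>

lemma sum_PiE_insert:
  fixes f :: "('i \<Rightarrow> 'b) \<Rightarrow> 'c::comm_monoid_add"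
  assumes "x \<notin> S"
  shows "(\<Sum>g\<in>PiE (insert x S) T. f g) = (\<Sum>y\<in>T x. \<Sum>g\<in>PiE S T. f (g(x := y)))"
proof -
  have "(\<Sum>g\<in>PiE (insert x S) T. f g) = (\<Sum>(y,g)\<in>T x \<times> PiE S T. f (g(x := y)))"
    unfolding PiE_insert_eq
    by (subst sum.reindex[OF inj_combinator[OF assms]]) (simp add: case_prod_unfold)
  then show ?thesis by (simp add: sum.cartesian_product)
qed

text \<open>
  The rows are read at \<open>j\<close> and the columns at \<open>i\<close>. Distinctness ensures that a later mode
  multiplication still sees the row index \<open>j t\<close> of the original multi-index.
\<close>
lemma fold_mode_mult:
  fixes X :: "'a::comm_semiring_1 tensor"
  assumes "distinct ts"
  shows "fold (\<lambda>t. mode_mult t (A t)) ts X j =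
    (\<Sum>i\<in>PiE (set ts) (\<lambda>t. {..<dim_col (A t)}).
       (\<Prod>t\<in>set ts. A t $$ (j t, i t)) * X (override_on j i (set ts)))"
  using assms
proof (induction ts arbitrary: X)
  case Nil
  then show ?case by (simp add: PiE_empty_domain)
next
  case (Cons t ts)
  let ?N = "\<lambda>t. {..<dim_col (A t)}"
  have t: "t \<notin> set ts" using Cons.prems by simp
  have ov: "override_on j (g(t := y)) (insert t (set ts)) = (override_on j g (set ts))(t := y)"
    for g y by (auto simp: override_on_def)
  have pr: "(\<Prod>u\<in>insert t (set ts). A u $$ (j u, (g(t := y)) u)) =
      A t $$ (j t, y) * (\<Prod>u\<in>set ts. A u $$ (j u, g u))" for g y
  proof -
    have "(\<Prod>u\<in>set ts. A u $$ (j u, (g(t := y)) u)) = (\<Prod>u\<in>set ts. A u $$ (j u, g u))"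
      using t by (intro prod.cong) auto
    then show ?thesis using t by simp
  qed
  have "fold (\<lambda>t. mode_mult t (A t)) (t # ts) X j =
      (\<Sum>g\<in>PiE (set ts) ?N. (\<Prod>u\<in>set ts. A u $$ (j u, g u)) *
         (\<Sum>y\<in>?N t. A t $$ (j t, y) * X ((override_on j g (set ts))(t := y))))"
    using Cons.IH[of "mode_mult t (A t) X"] Cons.prems t
    by (simp add: mode_mult_def[of _ _ X])
  also have "\<dots> = (\<Sum>y\<in>?N t. \<Sum>g\<in>PiE (set ts) ?N.
      (A t $$ (j t, y) * (\<Prod>u\<in>set ts. A u $$ (j u, g u))) *
        X ((override_on j g (set ts))(t := y)))"
    unfolding sum_distrib_left by (subst sum.swap) (simp add: mult_ac)
  also have "\<dots> = (\<Sum>i\<in>PiE (set (t # ts)) ?N.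
      (\<Prod>u\<in>set (t # ts). A u $$ (j u, i u)) * X (override_on j i (set (t # ts))))"
    by (simp only: list.set sum_PiE_insert[OF t] ov pr)
  finally show ?case .
qed

lemma dim_dft [simp]: "dim_row (dft m) = m" "dim_col (dft m) = m"
  by (simp_all add: dft_def)

lemma fourier_eq_sum:
  "fourier k n X j = (\<Sum>i\<in>freqs k n.
     (\<Prod>t=3..k. dft (n t) $$ (j t, i t)) * X (override_on j i {3..k}))"
proof -
  have "set [3..<Suc k] = {3..k}" by auto
  then show ?thesis
    unfolding fourier_def freqs_def by (subst fold_mode_mult) simp_all
qed

text \<open>
  The inverse is the entrywise conjugate of the symmetric matrix \<open>dft m\<close>, because a geometric sum
  over the powers of a nontrivial m-th root of unity vanishes. Its existence is what turns the
  partial function \<^const>\<open>mat_inverse\<close> inside \<^const>\<open>inv_dft\<close> into a genuine inverse.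
\<close>
lemma dft_inverse:
  assumes "m > 0"
  shows "dft m * inv_dft m = 1\<^sub>m m" "inv_dft m * dft m = 1\<^sub>m m" "inv_dft m \<in> carrier_mat m m"
proof -
  define w where "w = (\<lambda>p. cis (2 * pi * real p / real m))"
  have unit: "w p ^ m = 1" for p
    using assms by (simp add: w_def DeMoivre)
  have inj: "w p = w q \<longleftrightarrow> p = q" if "p < m" "q < m" for p q
    using bij_betw_imp_inj_on[OF bij_betw_roots_unity[OF assms]] that
    unfolding w_def inj_on_def by auto
  have wne: "w p \<noteq> 0" for p by (simp add: w_def)
  have dft: "dft m $$ (p,q) = cnj (w p) ^ q / sqrt m" if "p < m" "q < m" for p q
  proof -
    have "exp (- (2 * complex_of_real pi * \<i> / of_nat m)) = cnj (cis (2 * pi / real m))"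
      unfolding cis_cnj by (simp add: cis_conv_exp mult_ac)
    moreover have "cis (2 * pi / real m) ^ p = w p"
      by (simp add: DeMoivre w_def mult_ac)
    ultimately have "exp (- (2 * complex_of_real pi * \<i> / of_nat m)) ^ (p * q) = cnj (w p) ^ q"
      by (simp add: power_mult flip: complex_cnj_power)
    then show ?thesis using that by (simp add: dft_def)
  qed
  define D where "D = mat m m (\<lambda>(p,q). w q ^ p / complex_of_real (sqrt m))"
  have D: "D \<in> carrier_mat m m" by (simp add: D_def)
  have F: "dft m \<in> carrier_mat m m" by (simp add: dft_def)
  have "dft m * D = 1\<^sub>m m"
  proof (rule eq_matI)
    fix p q assume "p < dim_row (1\<^sub>m m :: complex mat)" "q < dim_col (1\<^sub>m m :: complex mat)"
    then have pq: "p < m" "q < m" by auto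
    let ?z = "cnj (w p) * w q"
    have s: "complex_of_real (sqrt m) * complex_of_real (sqrt m) = of_nat m"
      by (simp flip: of_real_mult)
    have "(dft m * D) $$ (p,q) = (\<Sum>l<m. dft m $$ (p,l) * D $$ (l,q))"
      using pq D F by (simp add: scalar_prod_def lessThan_atLeast0)
    also have "\<dots> = (\<Sum>l<m. ?z ^ l / of_nat m)"
      using pq by (intro sum.cong) (auto simp: dft D_def power_mult_distrib s)
    also have "\<dots> = (\<Sum>l<m. ?z ^ l) / of_nat m" by (simp add: sum_divide_distrib)
    also have "\<dots> = (if p = q then 1 else 0)"
    proof (cases "p = q")
      case True
      have "?z = 1" unfolding True w_def by (simp add: cis_cnj cis_mult)
      then show ?thesis using True assms by simp
    next
      case False
      have "cnj (w p) * w p = 1" unfolding w_def by (simp add: cis_cnj cis_mult)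
      then have "?z \<noteq> 1" using False inj[OF pq] wne
        by (metis mult_cancel_left complex_cnj_zero_iff)
      moreover have "?z ^ m = 1"
        using unit by (simp add: power_mult_distrib flip: complex_cnj_power)
      ultimately show ?thesis using False by (simp add: sum_gp_strict)
    qed
    finally show "(dft m * D) $$ (p,q) = 1\<^sub>m m $$ (p,q)" using pq by simp
  qed (simp_all add: D_def)
  moreover from mat_mult_left_right_inverse[OF F D this] have "D * dft m = 1\<^sub>m m" .
  ultimately have "dft m \<in> Units (ring_mat TYPE(complex) m ())"
    using D F unfolding Units_def ring_mat_def by auto
  then obtain B where "mat_inverse (dft m) = Some B"
    using mat_inverse(1)[OF F, where b = "()"] by (cases "mat_inverse (dft m)") auto
  with mat_inverse(2)[OF F this]
  show "dft m * inv_dft m = 1\<^sub>m m" "inv_dft m * dft m = 1\<^sub>m m" "inv_dft m \<in> carrier_mat m m"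
    by (simp_all add: inv_dft_def)
qed

lemma inv_fourier_eq_sum:
  assumes "\<forall>t\<in>{3..k}. n t > 0"
  shows "inv_fourier k n X j = (\<Sum>i\<in>freqs k n.
     (\<Prod>t=3..k. inv_dft (n t) $$ (j t, i t)) * X (override_on j i {3..k}))"
proof -
  have "set [3..<Suc k] = {3..k}" by auto
  moreover have "PiE {3..k} (\<lambda>t. {..<dim_col (inv_dft (n t))}) = freqs k n"
    unfolding freqs_def using assms carrier_matD(2)[OF dft_inverse(3)] by (intro PiE_cong) auto
  ultimately show ?thesis
    unfolding inv_fourier_def by (subst fold_mode_mult) simp_all
qed

text \<open>
  After exchanging the two sums, the inner one is the product over the modes of entries of
  \<open>A t * B t\<close>, that is, a product of Kronecker deltas. Stating this for two families of matrices
  gives both orders of composition of the Fourier transform and its inverse.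
\<close>
lemma multi_sum_inverse:
  fixes X :: "'a::comm_ring_1 tensor" and A B :: "nat \<Rightarrow> 'a mat"
  assumes AB: "\<forall>t\<in>{3..k}. A t \<in> carrier_mat (n t) (n t) \<and> B t \<in> carrier_mat (n t) (n t) \<and>
      A t * B t = 1\<^sub>m (n t)"
    and j: "\<forall>t\<in>{3..k}. j t < n t"
  shows "(\<Sum>i\<in>freqs k n. (\<Prod>t=3..k. A t $$ (j t, i t)) *
      (\<Sum>l\<in>freqs k n. (\<Prod>t=3..k. B t $$ (override_on j i {3..k} t, l t)) *
         X (override_on (override_on j i {3..k}) l {3..k}))) = X j"
proof -
  have ov: "override_on (override_on j i {3..k}) l {3..k} = override_on j l {3..k}" for i l
    by (auto simp: override_on_def)
  have pr: "(\<Prod>t=3..k. B t $$ (override_on j i {3..k} t, l t)) = (\<Prod>t=3..k. B t $$ (i t, l t))"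
    for i l by (rule prod.cong) auto
  have ent: "(\<Sum>i<n t. A t $$ (j t, i) * B t $$ (i, l t)) = (if j t = l t then 1 else 0)"
    if "t \<in> {3..k}" "l \<in> freqs k n" for t l
  proof -
    have lt: "l t < n t" "j t < n t" using that j by (auto simp: freqs_def)
    have "dim_row (A t) = n t" "dim_col (A t) = n t" "dim_row (B t) = n t" "dim_col (B t) = n t"
      using AB that by auto
    then have "(A t * B t) $$ (j t, l t) = (\<Sum>i<n t. A t $$ (j t, i) * B t $$ (i, l t))"
      using lt by (simp add: scalar_prod_def lessThan_atLeast0)
    then show ?thesis using AB that lt by simp
  qed
  have fin: "finite (freqs k n)" unfolding freqs_def by (intro finite_PiE) auto
  have rj: "restrict j {3..k} \<in> freqs k n" using j by (auto simp: freqs_def)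
  have "(\<Sum>i\<in>freqs k n. (\<Prod>t=3..k. A t $$ (j t, i t)) *
      (\<Sum>l\<in>freqs k n. (\<Prod>t=3..k. B t $$ (i t, l t)) * X (override_on j l {3..k})))
    = (\<Sum>l\<in>freqs k n. (\<Sum>i\<in>freqs k n. \<Prod>t=3..k. A t $$ (j t, i t) * B t $$ (i t, l t)) *
        X (override_on j l {3..k}))"
    unfolding sum_distrib_left sum_distrib_right prod.distrib
    by (subst sum.swap) (simp add: mult_ac)
  also have "\<dots> = (\<Sum>l\<in>freqs k n. (\<Prod>t=3..k. \<Sum>i<n t. A t $$ (j t, i) * B t $$ (i, l t)) *
        X (override_on j l {3..k}))"
    unfolding freqs_def by (subst prod_sum_PiE) auto
  also have "\<dots> = (\<Sum>l\<in>freqs k n. if l = restrict j {3..k} then X j else 0)"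
  proof (rule sum.cong[OF refl])
    fix l assume l: "l \<in> freqs k n"
    have eq: "l = restrict j {3..k} \<longleftrightarrow> (\<forall>t\<in>{3..k}. j t = l t)"
    proof
      assume "\<forall>t\<in>{3..k}. j t = l t"
      then show "l = restrict j {3..k}"
        using l by (intro ext) (auto simp: freqs_def PiE_def extensional_def)
    qed auto
    show "(\<Prod>t=3..k. \<Sum>i<n t. A t $$ (j t, i) * B t $$ (i, l t)) * X (override_on j l {3..k})
        = (if l = restrict j {3..k} then X j else 0)"
    proof (cases "l = restrict j {3..k}")
      case True
      then have "override_on j l {3..k} = j" by (auto simp: override_on_def)
      then show ?thesis using True ent[OF _ l] eq by simp
    next
      case False
      then obtain t where "t \<in> {3..k}" "j t \<noteq> l t" using eq by blast
      then have "(\<Prod>t=3..k. \<Sum>i<n t. A t $$ (j t, i) * B t $$ (i, l t)) = 0"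
        using ent[OF _ l] by (intro prod_zero) auto
      then show ?thesis using False by simp
    qed
  qed
  also have "\<dots> = X j" using fin rj by simp
  finally show ?thesis unfolding ov pr .
qed

lemma fourier_inv_fourier:
  assumes "\<forall>t\<in>{3..k}. n t > 0" "\<forall>t\<in>{3..k}. j t < n t"
  shows "fourier k n (inv_fourier k n X) j = X j"
  unfolding fourier_eq_sum inv_fourier_eq_sum[OF assms(1)]
  using assms dft_inverse by (intro multi_sum_inverse) (auto simp: dft_def)

lemma inv_fourier_fourier:
  assumes "\<forall>t\<in>{3..k}. n t > 0" "\<forall>t\<in>{3..k}. j t < n t"
  shows "inv_fourier k n (fourier k n X) j = X j"
  unfolding fourier_eq_sum inv_fourier_eq_sum[OF assms(1)]
  using assms dft_inverse by (intro multi_sum_inverse) (auto simp: dft_def)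

section \<open>Faces in the Fourier domain\<close>

lemma face_fourier_hprod:
  assumes "\<forall>t\<in>{3..k}. n t > 0" "\<beta> \<in> freqs k n"
  shows "face m p (fourier k n (hprod k n l A B)) \<beta> =
    face m l (fourier k n A) \<beta> * face l p (fourier k n B) \<beta>"
proof (rule eq_matI)
  fix a b assume "a < dim_row (face m l (fourier k n A) \<beta> * face l p (fourier k n B) \<beta>)"
    "b < dim_col (face m l (fourier k n A) \<beta> * face l p (fourier k n B) \<beta>)"
  then have ab: "a < m" "b < p" by (auto simp: face_def)
  have "fourier k n (hprod k n l A B) (\<beta>(1 := a, 2 := b)) =
      facewise l (fourier k n A) (fourier k n B) (\<beta>(1 := a, 2 := b))"
    unfolding hprod_def using assms by (intro fourier_inv_fourier) (auto simp: freqs_def)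
  also have "\<dots> = (\<Sum>c<l. fourier k n A (\<beta>(1 := a, 2 := c)) * fourier k n B (\<beta>(1 := c, 2 := b)))"
    unfolding facewise_def by (simp add: fun_upd_twist[of "Suc 0" 2])
  finally show "face m p (fourier k n (hprod k n l A B)) \<beta> $$ (a, b) =
      (face m l (fourier k n A) \<beta> * face l p (fourier k n B) \<beta>) $$ (a, b)"
    using ab by (simp add: face_def scalar_prod_def lessThan_atLeast0)
qed (simp_all add: face_def)

lemma dim_mat_adjoint [simp]:
  "dim_row (mat_adjoint A) = dim_col A" "dim_col (mat_adjoint A) = dim_row A"
  by (simp_all add: mat_adjoint_def)

lemma index_mat_adjoint [simp]:
  "i < dim_col A \<Longrightarrow> j < dim_row A \<Longrightarrow> mat_adjoint A $$ (i,j) = conjugate (A $$ (j,i))"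
  by (simp add: mat_adjoint_def mat_of_rows_index)

lemma face_fourier_htranspose:
  assumes "\<forall>t\<in>{3..k}. n t > 0" "\<beta> \<in> freqs k n"
  shows "face m p (fourier k n (htranspose k n X)) \<beta> = mat_adjoint (face p m (fourier k n X) \<beta>)"
proof (rule eq_matI)
  fix a b assume "a < dim_row (mat_adjoint (face p m (fourier k n X) \<beta>))"
    "b < dim_col (mat_adjoint (face p m (fourier k n X) \<beta>))"
  then have ab: "a < m" "b < p" by (auto simp: face_def)
  have "fourier k n (htranspose k n X) (\<beta>(1 := a, 2 := b)) = 
      cnj (fourier k n X (\<beta>(1 := b, 2 := a)))"
    unfolding htranspose_def using assms
    by (subst fourier_inv_fourier) (auto simp: freqs_def fun_upd_twist[of 1 2])
  then show "face m p (fourier k n (htranspose k n X)) \<beta> $$ (a, b) =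
      mat_adjoint (face p m (fourier k n X) \<beta>) $$ (a, b)"
    using ab by (simp add: face_def)
qed (simp_all add: face_def)

text \<open>
  The faces hold all entries of the transform at indices within the sizes, and the inverse
  transform at such an index reads no others.
\<close>
lemma tensor_eqI_fourier_faces:
  assumes "\<forall>t\<in>{3..k}. n t > 0" "k \<ge> 2"
    and faces: "\<And>\<beta>. \<beta> \<in> freqs k n \<Longrightarrow>
      face (n 1) (n 2) (fourier k n X) \<beta> = face (n 1) (n 2) (fourier k n Y) \<beta>"
    and j: "j \<in> indices k n"
  shows "X j = Y j"
proof -
  have jn: "\<forall>t\<in>{1..k}. j t < n t" using j by (auto simp: indices_def)
  have "fourier k n X i = fourier k n Y i" if i: "i \<in> indices k n" for i
  proof -
    let ?\<beta> = "restrict i {3..k}"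
    have \<beta>: "?\<beta> \<in> freqs k n" using i by (auto simp: indices_def freqs_def)
    have eq: "?\<beta>(1 := i 1, 2 := i 2) = i"
    proof
      fix t
      consider "t = 1" | "t = 2" | "t \<in> {3..k}" | "t \<notin> {1..k}" by force
      \<comment> \<open>outside \<open>1..k\<close> (in particular at 0) both sides are \<^const>\<open>undefined\<close>\<close>
      then show "(?\<beta>(1 := i 1, 2 := i 2)) t = i t"
        using i \<open>k \<ge> 2\<close> by cases (auto simp: indices_def PiE_def extensional_def)
    qed
    have "i 1 < n 1" "i 2 < n 2" using i \<open>k \<ge> 2\<close> by (auto simp: indices_def)
    then show ?thesis
      using arg_cong[OF faces[OF \<beta>], of "\<lambda>M. M $$ (i 1, i 2)"] eq by (simp add: face_def)
  qed
  moreover have "override_on j i {3..k} \<in> indices k n" if "i \<in> freqs k n" for i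
    using j that by (auto simp: indices_def freqs_def override_on_def PiE_def extensional_def Pi_def)
  ultimately have "inv_fourier k n (fourier k n X) j = inv_fourier k n (fourier k n Y) j"
    unfolding inv_fourier_eq_sum[OF assms(1)] by (intro sum.cong) auto
  then show ?thesis
    using jn assms(1) by (simp add: inv_fourier_fourier)
qed

section \<open>Tensor trains\<close>

text \<open>
  Separates the two auxiliary indices that do not link transform modes: index 0 takes only the
  value 0, and index 1 becomes the summation index of a matrix product.
\<close>
lemma ttd_split_first:
  assumes "2 \<le> k" "\<rho> 0 = 1"
  shows "ttd k \<rho> C j = (\<Sum>c<\<rho> 1. \<Sum>\<alpha>\<in>(\<Pi>\<^sub>E t\<in>{2..k}. {..<\<rho> t}).
    C 1 0 (j 1) c * (C 2 c (j 2) (\<alpha> 2) * (\<Prod>t=3..k. C t (\<alpha> (t - 1)) (j t) (\<alpha> t))))"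
proof -
  have I: "{0..k} = insert 0 (insert 1 {2..k})" and J: "{1..k} = insert 1 (insert 2 {3..k})"
    using assms by auto
  have "(\<Prod>t=1..k. C t ((\<alpha>(1 := c, 0 := 0)) (t - 1)) (j t) ((\<alpha>(1 := c, 0 := 0)) t)) =
      C 1 0 (j 1) c * (C 2 c (j 2) (\<alpha> 2) * (\<Prod>t=3..k. C t (\<alpha> (t - 1)) (j t) (\<alpha> t)))" for \<alpha> c
  proof -
    have "(\<Prod>t=3..k. C t ((\<alpha>(1 := c, 0 := 0)) (t - 1)) (j t) ((\<alpha>(1 := c, 0 := 0)) t)) =
        (\<Prod>t=3..k. C t (\<alpha> (t - 1)) (j t) (\<alpha> t))"
      by (intro prod.cong) auto
    then show ?thesis unfolding J by simp
  qed
  then show ?thesis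
    unfolding ttd_def I using assms by (simp add: sum_PiE_insert lessThan_Suc)
qed

text \<open>
  Each entry of the tensor train is a sum of products in which mode t enters through core t only, so
  the sum over all frequency tuples factors into one mode-2 transform per core.
\<close>
lemma fourier_ttd:
  assumes "2 \<le> k" "r 0 = 1"
  shows "fourier k n (\<lambda>j. complex_of_real (ttd k r G j)) j =
    (\<Sum>c<r 1. \<Sum>\<alpha>\<in>(\<Pi>\<^sub>E t\<in>{2..k}. {..<r t}).
       complex_of_real (G 1 0 (j 1) c) * (complex_of_real (G 2 c (j 2) (\<alpha> 2)) *
       (\<Prod>t=3..k. fourier_cores n G t (\<alpha> (t - 1)) (j t) (\<alpha> t))))"
proof -
  let ?g = "\<lambda>c \<alpha>. complex_of_real (G 1 0 (j 1) c) * complex_of_real (G 2 c (j 2) (\<alpha> 2))"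
  let ?p = "\<lambda>i \<alpha>. \<Prod>t=3..k. dft (n t) $$ (j t, i t) * complex_of_real (G t (\<alpha> (t - 1)) (i t) (\<alpha> t))"
  have ov: "(\<Prod>t=3..k. complex_of_real (G t (\<alpha> (t - 1)) (override_on j i {3..k} t) (\<alpha> t))) =
      (\<Prod>t=3..k. complex_of_real (G t (\<alpha> (t - 1)) (i t) (\<alpha> t)))" for i \<alpha>
    by (intro prod.cong) auto
  have "fourier k n (\<lambda>j. complex_of_real (ttd k r G j)) j =
      (\<Sum>i\<in>freqs k n. \<Sum>c<r 1. \<Sum>\<alpha>\<in>(\<Pi>\<^sub>E t\<in>{2..k}. {..<r t}). ?g c \<alpha> * ?p i \<alpha>)"
    unfolding fourier_eq_sum ttd_split_first[of k r, OF assms]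
    by (simp add: ov sum_distrib_left prod.distrib mult_ac)
  also have "\<dots> = (\<Sum>c<r 1. \<Sum>\<alpha>\<in>(\<Pi>\<^sub>E t\<in>{2..k}. {..<r t}). \<Sum>i\<in>freqs k n. ?g c \<alpha> * ?p i \<alpha>)"
    by (subst sum.swap, rule sum.cong[OF refl], rule sum.swap)
  also have "\<dots> = (\<Sum>c<r 1. \<Sum>\<alpha>\<in>(\<Pi>\<^sub>E t\<in>{2..k}. {..<r t}). ?g c \<alpha> *
      (\<Prod>t=3..k. fourier_cores n G t (\<alpha> (t - 1)) (j t) (\<alpha> t)))"
    unfolding fourier_cores_def freqs_def by (simp add: prod_sum_PiE sum_distrib_left)
  finally show ?thesis by (simp add: mult_ac)
qed

lemma face_fourier_ttd:
  assumes "2 \<le> k" "r 0 = 1"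
    and QR: "matricize2 n r G = Q2 * R2" "Q2 \<in> carrier_mat (n 2) q" "R2 \<in> carrier_mat q (r 1 * r 2)"
  shows "face (n 1) (n 2) (fourier k n (\<lambda>j. complex_of_real (ttd k r G j))) \<beta> =
    map_mat complex_of_real (matricize1 n r G) *
    (B_mat k n r G R2 \<beta> * transpose_mat (map_mat complex_of_real Q2))" (is "_ = ?G1 * (?B * ?Q)")
proof (rule eq_matI)
  fix a b assume "a < dim_row (?G1 * (?B * ?Q))" "b < dim_col (?G1 * (?B * ?Q))"
  then have ab: "a < n 1" "b < n 2" using QR by (auto simp: matricize1_def)
  let ?P = "\<lambda>\<alpha>. \<Prod>t=3..k. fourier_cores n G t (\<alpha> (t - 1)) (\<beta> t) (\<alpha> t)"
  let ?I = "\<Pi>\<^sub>E t\<in>{2..k}. {..<r t}"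
  have G2: "complex_of_real (G 2 c b (\<alpha> 2)) =
      (\<Sum>\<eta><q. complex_of_real (Q2 $$ (b,\<eta>)) * complex_of_real (R2 $$ (\<eta>, c + \<alpha> 2 * r 1)))"
    if "c < r 1" "\<alpha> \<in> ?I" for c \<alpha>
  proof -
    have a2: "\<alpha> 2 < r 2" using that \<open>2 \<le> k\<close> by auto
    have "c + \<alpha> 2 * r 1 < Suc (\<alpha> 2) * r 1" using that by simp
    also have "\<dots> \<le> r 2 * r 1" using a2 by (intro mult_right_mono) auto
    finally have bd: "c + \<alpha> 2 * r 1 < r 1 * r 2" by (simp add: mult.commute)
    have "G 2 c b (\<alpha> 2) = matricize2 n r G $$ (b, c + \<alpha> 2 * r 1)"
      using bd ab that by (simp add: matricize2_def)
    also have "\<dots> = (\<Sum>\<eta><q. Q2 $$ (b,\<eta>) * R2 $$ (\<eta>, c + \<alpha> 2 * r 1))"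
      unfolding QR(1) using bd ab QR by (simp add: scalar_prod_def lessThan_atLeast0)
    finally show ?thesis by simp
  qed
  have prodP: "(\<Prod>t=3..k. fourier_cores n G t (\<alpha> (t - 1)) ((\<beta>(1 := a, 2 := b)) t) (\<alpha> t)) = ?P \<alpha>"
    for \<alpha> by (intro prod.cong) auto
  have "face (n 1) (n 2) (fourier k n (\<lambda>j. complex_of_real (ttd k r G j))) \<beta> $$ (a, b) =
      (\<Sum>c<r 1. \<Sum>\<alpha>\<in>?I. complex_of_real (G 1 0 a c) *
        (complex_of_real (G 2 c b (\<alpha> 2)) * ?P \<alpha>))"
    using ab by (simp add: face_def fourier_ttd[where r = r, OF assms(1,2)] prodP
      del: fun_upd_apply) simp
  also have "\<dots> = (\<Sum>c<r 1. \<Sum>\<alpha>\<in>?I. complex_of_real (G 1 0 a c) *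
      ((\<Sum>\<eta><q. complex_of_real (Q2 $$ (b,\<eta>)) * complex_of_real (R2 $$ (\<eta>, c + \<alpha> 2 * r 1))) * ?P \<alpha>))"
    by (intro sum.cong refl) (simp add: G2)
  also have "\<dots> = (\<Sum>c<r 1. complex_of_real (G 1 0 a c) * (\<Sum>\<eta><q.
      (\<Sum>\<alpha>\<in>?I. complex_of_real (R2 $$ (\<eta>, c + \<alpha> 2 * r 1)) * ?P \<alpha>) * complex_of_real (Q2 $$ (b,\<eta>))))"
    unfolding sum_distrib_left sum_distrib_right
    by (rule sum.cong[OF refl], subst sum.swap) (simp add: mult_ac)
  also have "\<dots> = (?G1 * (?B * ?Q)) $$ (a, b)"
    using ab QR by (simp add: matricize1_def B_mat_def scalar_prod_def lessThan_atLeast0)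
  finally show "face (n 1) (n 2) (fourier k n (\<lambda>j. complex_of_real (ttd k r G j))) \<beta> $$ (a, b) =
      (?G1 * (?B * ?Q)) $$ (a, b)" .
qed (use QR in \<open>simp_all add: face_def matricize1_def\<close>)

section \<open>The factor tensors\<close>

text \<open>
  Bound of a mixed-radix number by the product of its radices; it places the auxiliary indices
  within the ranks of the factor tensors.
\<close>
lemma comb_index_less:
  assumes "\<beta> \<in> freqs k n" "3 \<le> t" "t \<le> Suc k"
  shows "comb_index k n \<beta> t < (\<Prod>u=t..k. n u)"
  using assms(3,2)
proof (induction t rule: inc_induct)
  case base
  then show ?case by (simp add: comb_index.simps)
next
  case (step t)
  have "\<beta> t < n t" using assms(1) step by (auto simp: freqs_def)
  then have "\<beta> t + comb_index k n \<beta> (Suc t) * n t < Suc (comb_index k n \<beta> (Suc t)) * n t" by simp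
  also have "\<dots> \<le> (\<Prod>u=Suc t..k. n u) * n t"
    using step by (intro mult_right_mono) auto
  also have "\<dots> = (\<Prod>u=t..k. n u)"
    using step by (simp add: prod.atLeast_Suc_atMost mult.commute)
  finally show ?case using step by (subst comb_index.simps) simp
qed

text \<open>
  The digits are recovered successively by \<open>mod\<close> and \<open>div\<close>.
\<close>
lemma freq_of_comb_index:
  assumes "\<beta> \<in> freqs k n"
  shows "freq_of k n (comb_index k n \<beta> 3) = \<beta>"
proof -
  have "inj_on (\<lambda>\<beta>. comb_index k n \<beta> 3) (freqs k n)"
  proof (rule inj_onI)
    fix x y assume xy: "x \<in> freqs k n" "y \<in> freqs k n"
      and eq: "comb_index k n x 3 = comb_index k n y 3"
    have rec: "z t = comb_index k n z t mod n t \<and> comb_index k n z (Suc t) = comb_index k n z t div n t"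
      if "z \<in> freqs k n" "t \<in> {3..k}" for z t
    proof -
      have "z t < n t" using that by (auto simp: freqs_def)
      then show ?thesis using that by (subst (1 3) comb_index.simps) simp
    qed
    have comb: "comb_index k n x t = comb_index k n y t" if "3 \<le> t" "t \<le> Suc k" for t
      using that
    proof (induction t rule: dec_induct)
      case (step t)
      then show ?case using rec[OF xy(1), of t] rec[OF xy(2), of t] by simp
    qed (use eq in simp)
    show "x = y"
    proof
      fix t
      show "x t = y t"
      proof (cases "t \<in> {3..k}")
        case True
        then show ?thesis using rec[OF xy(1) True] rec[OF xy(2) True] comb[of t] by simp
      qed (use xy in \<open>auto simp: freqs_def PiE_def extensional_def\<close>)
    qed
  qed
  then show ?thesis using assms unfolding freq_of_def by (rule inv_into_f_f)
qed

text \<open>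
  The last auxiliary index ranges over an empty product, so it is 0. Going down from there, the
  chain condition forces \<open>\<alpha> (t - 1)\<close> to be the combined index at t for every t, which leaves a
  single summand.
\<close>
lemma sum_comb_index_chain:
  fixes h :: "nat \<Rightarrow> 'a::comm_monoid_add"
  assumes "2 \<le> k" "\<beta> \<in> freqs k n"
  shows "(\<Sum>\<alpha>\<in>(\<Pi>\<^sub>E t\<in>{2..k}. {..<\<Prod>u=Suc t..k. n u}).
      if \<forall>t\<in>{3..k}. \<alpha> (t - 1) = \<beta> t + \<alpha> t * n t then h (\<alpha> 2) else 0) = h (comb_index k n \<beta> 3)"
proof -
  let ?I = "\<Pi>\<^sub>E t\<in>{2..k}. {..<\<Prod>u=Suc t..k. n u}"
  define \<alpha>0 where "\<alpha>0 = restrict (\<lambda>t. comb_index k n \<beta> (Suc t)) {2..k}"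
  have \<alpha>0: "\<alpha>0 \<in> ?I" using comb_index_less[OF assms(2)] by (auto simp: \<alpha>0_def)
  have chain: "(\<forall>t\<in>{3..k}. \<alpha> (t - 1) = \<beta> t + \<alpha> t * n t) \<longleftrightarrow> \<alpha> = \<alpha>0" if \<alpha>: "\<alpha> \<in> ?I" for \<alpha>
  proof
    assume ch: "\<forall>t\<in>{3..k}. \<alpha> (t - 1) = \<beta> t + \<alpha> t * n t"
    have "\<alpha> t = comb_index k n \<beta> (Suc t)" if "2 \<le> t" "t \<le> k" for t
      using that(2,1)
    proof (induction t rule: inc_induct)
      case base
      then have "\<alpha> k \<in> {..<\<Prod>u=Suc k..k. n u}" using \<alpha> by (intro PiE_mem[OF \<alpha>]) auto
      then show ?case by (simp add: comb_index.simps)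
    next
      case (step t)
      then show ?case using ch[rule_format, of "Suc t"] by (subst comb_index.simps) simp
    qed
    then show "\<alpha> = \<alpha>0"
      using \<alpha> by (intro ext) (auto simp: \<alpha>0_def PiE_def extensional_def)
  next
    assume eq: "\<alpha> = \<alpha>0"
    show "\<forall>t\<in>{3..k}. \<alpha> (t - 1) = \<beta> t + \<alpha> t * n t"
    proof
      fix t assume t: "t \<in> {3..k}"
      then have "\<alpha> (t - 1) = comb_index k n \<beta> t" "\<alpha> t = comb_index k n \<beta> (Suc t)"
        unfolding eq by (auto simp: \<alpha>0_def)
      then show "\<alpha> (t - 1) = \<beta> t + \<alpha> t * n t"
        using t comb_index.simps[of k n \<beta> t] by simp
    qed
  qed
  have "finite ?I" by (intro finite_PiE) auto
  have "(\<Sum>\<alpha>\<in>?I. if \<forall>t\<in>{3..k}. \<alpha> (t - 1) = \<beta> t + \<alpha> t * n t then h (\<alpha> 2) else 0) =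
      (\<Sum>\<alpha>\<in>?I. if \<alpha> = \<alpha>0 then h (\<alpha>0 2) else 0)"
    using chain by (intro sum.cong) auto
  also have "\<dots> = h (comb_index k n \<beta> 3)"
    using \<alpha>0 \<open>finite ?I\<close> assms(1) by (simp add: \<alpha>0_def)
  finally show ?thesis .
qed

text \<open>
  Expanding the product of the transform-mode cores chooses one digit per mode, that is, a frequency
  tuple \<open>\<beta>\<close>. For fixed \<open>\<beta>\<close> the sum over the auxiliary indices collapses to the chain of its
  combined indices, whose first member selects \<open>Z \<beta>\<close> in core 2. The entries of the inverse
  Fourier matrices that are left over form the kernel of \<^const>\<open>inv_fourier\<close>.
\<close>
lemma factor_tensor_eq_inv_fourier:
  assumes "2 \<le> k" "\<forall>t\<in>{3..k}. n t > 0"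
  shows "factor_tensor k n W Z j =
    inv_fourier k n (\<lambda>j. \<Sum>c<dim_col W. W $$ (j 1, c) * Z (restrict j {3..k}) $$ (c, j 2)) j"
proof -
  let ?I = "\<Pi>\<^sub>E t\<in>{2..k}. {..<\<Prod>u=Suc t..k. n u}"
  let ?D = "\<lambda>\<beta>. \<Prod>t=3..k. inv_dft (n t) $$ (j t, \<beta> t)"
  let ?ch = "\<lambda>\<alpha> \<beta>. \<forall>t\<in>{3..k}. \<alpha> (t - 1) = \<beta> t + \<alpha> t * n t"
  have I: "(\<Pi>\<^sub>E t\<in>{2..k}. {..<factor_ranks k n p t}) = ?I" for p
    by (intro PiE_cong) (auto simp: factor_ranks_def)
  have ranks: "factor_ranks k n p 0 = 1" "factor_ranks k n p 1 = p" for p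
    by (simp_all add: factor_ranks_def)
  have factor1: "factor_cores k n W Z 1 a i b = W $$ (i, b)"
    and factor2: "factor_cores k n W Z 2 a i b = Z (freq_of k n b) $$ (a, i)" for a i b
    by (simp_all add: factor_cores_def)
  have cores: "(\<Prod>t=3..k. factor_cores k n W Z t (\<alpha> (t - 1)) (j t) (\<alpha> t)) =
      (\<Sum>\<beta>\<in>freqs k n. if ?ch \<alpha> \<beta> then ?D \<beta> else 0)" for \<alpha>
  proof -
    have "(\<Prod>t=3..k. factor_cores k n W Z t (\<alpha> (t - 1)) (j t) (\<alpha> t)) =
        (\<Prod>t=3..k. \<Sum>b<n t. if \<alpha> (t - 1) = b + \<alpha> t * n t then inv_dft (n t) $$ (j t, b) else 0)"
      by (intro prod.cong) (auto simp: factor_cores_def)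
    also have "\<dots> = (\<Sum>\<beta>\<in>freqs k n. \<Prod>t=3..k.
        if \<alpha> (t - 1) = \<beta> t + \<alpha> t * n t then inv_dft (n t) $$ (j t, \<beta> t) else 0)"
      unfolding freqs_def by (rule prod_sum_PiE) auto
    also have "\<dots> = (\<Sum>\<beta>\<in>freqs k n. if ?ch \<alpha> \<beta> then ?D \<beta> else 0)"
    proof (rule sum.cong[OF refl])
      fix \<beta>
      show "(\<Prod>t=3..k. if \<alpha> (t - 1) = \<beta> t + \<alpha> t * n t then inv_dft (n t) $$ (j t, \<beta> t) else 0) =
          (if ?ch \<alpha> \<beta> then ?D \<beta> else 0)"
      proof (cases "?ch \<alpha> \<beta>")
        case False
        then show ?thesis by (subst if_not_P[OF False]) (intro prod_zero, auto)
      qed (auto intro!: prod.cong)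
    qed
    finally show ?thesis .
  qed
  have "factor_tensor k n W Z j = (\<Sum>c<dim_col W. \<Sum>\<alpha>\<in>?I. W $$ (j 1, c) *
      (Z (freq_of k n (\<alpha> 2)) $$ (c, j 2) * (\<Sum>\<beta>\<in>freqs k n. if ?ch \<alpha> \<beta> then ?D \<beta> else 0)))"
    unfolding factor_tensor_def
    by (subst ttd_split_first) (simp_all only: assms I cores ranks factor1 factor2)
  also have "\<dots> = (\<Sum>c<dim_col W. \<Sum>\<beta>\<in>freqs k n. \<Sum>\<alpha>\<in>?I.
      if ?ch \<alpha> \<beta> then W $$ (j 1, c) * (Z (freq_of k n (\<alpha> 2)) $$ (c, j 2) * ?D \<beta>) else 0)"
    unfolding sum_distrib_left
    by (rule sum.cong[OF refl], subst sum.swap) (intro sum.cong refl, simp)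
  also have "\<dots> = (\<Sum>c<dim_col W. \<Sum>\<beta>\<in>freqs k n. W $$ (j 1, c) * (Z \<beta> $$ (c, j 2) * ?D \<beta>))"
  proof (intro sum.cong refl)
    fix c \<beta> assume \<beta>: "\<beta> \<in> freqs k n"
    show "(\<Sum>\<alpha>\<in>?I. if ?ch \<alpha> \<beta>
          then W $$ (j 1, c) * (Z (freq_of k n (\<alpha> 2)) $$ (c, j 2) * ?D \<beta>) else 0) =
        W $$ (j 1, c) * (Z \<beta> $$ (c, j 2) * ?D \<beta>)"
      using sum_comb_index_chain[OF assms(1) \<beta>,
          of "\<lambda>b. W $$ (j 1, c) * (Z (freq_of k n b) $$ (c, j 2) * ?D \<beta>)"]
      unfolding freq_of_comb_index[OF \<beta>] .
  qed
  also have "\<dots> = (\<Sum>\<beta>\<in>freqs k n. ?D \<beta> * (\<Sum>c<dim_col W. W $$ (j 1, c) * Z \<beta> $$ (c, j 2)))"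
    unfolding sum_distrib_left by (subst sum.swap) (simp add: mult_ac)
  also have "\<dots> = inv_fourier k n
      (\<lambda>j. \<Sum>c<dim_col W. W $$ (j 1, c) * Z (restrict j {3..k}) $$ (c, j 2)) j"
  proof -
    have "restrict (override_on j \<beta> {3..k}) {3..k} = \<beta>" if "\<beta> \<in> freqs k n" for \<beta>
      using that by (intro ext) (auto simp: freqs_def PiE_def extensional_def)
    then show ?thesis by (simp add: inv_fourier_eq_sum[OF assms(2)])
  qed
  finally show ?thesis .
qed

lemma face_fourier_factor_tensor:
  assumes "2 \<le> k" "\<forall>t\<in>{3..k}. n t > 0" "\<beta> \<in> freqs k n"
    and W: "W \<in> carrier_mat m p" and Z: "Z \<beta> \<in> carrier_mat p q"
  shows "face m q (fourier k n (factor_tensor k n W Z)) \<beta> = W * Z \<beta>"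
proof (rule eq_matI)
  fix a b assume "a < dim_row (W * Z \<beta>)" "b < dim_col (W * Z \<beta>)"
  then have ab: "a < m" "b < q" using W Z by auto
  have r: "restrict (\<beta>(1 := a, 2 := b)) {3..k} = \<beta>"
    using assms(3) by (intro ext) (auto simp: freqs_def PiE_def extensional_def)
  have "factor_tensor k n W Z = inv_fourier k n
      (\<lambda>j. \<Sum>c<dim_col W. W $$ (j 1, c) * Z (restrict j {3..k}) $$ (c, j 2))"
    using factor_tensor_eq_inv_fourier[OF assms(1,2)] by blast
  then have "fourier k n (factor_tensor k n W Z) (\<beta>(1 := a, 2 := b)) =
      (\<Sum>c<dim_col W. W $$ (a, c) * Z (restrict (\<beta>(1 := a, 2 := b)) {3..k}) $$ (c, b))"
    using assms(2,3) by (simp only:, subst fourier_inv_fourier) (auto simp: freqs_def)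
  then show "face m q (fourier k n (factor_tensor k n W Z)) \<beta> $$ (a, b) = (W * Z \<beta>) $$ (a, b)"
    using ab W Z unfolding r by (simp add: face_def scalar_prod_def lessThan_atLeast0)
qed (use W Z in \<open>simp_all add: face_def\<close>)

section \<open>The higher-order singular value decomposition\<close>

lemma mat_adjoint_mult:
  fixes A B :: "complex mat"
  assumes "A \<in> carrier_mat m p" "B \<in> carrier_mat p q"
  shows "mat_adjoint (A * B) = mat_adjoint B * mat_adjoint A"
  using assms by (intro eq_matI) (auto simp: scalar_prod_def mult.commute)

lemma orthonormal_cols_iff:
  fixes A :: "complex mat"
  shows "orthonormal_cols A \<longleftrightarrow> mat_adjoint A * A = 1\<^sub>m (dim_col A)"
proof -
  have *: "(mat_adjoint A * A) $$ (i,j) = col A j \<bullet>c col A i" if "i < dim_col A" "j < dim_col A" for i j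
    using that by (simp add: scalar_prod_def mult.commute)
  have "mat_adjoint A * A = 1\<^sub>m (dim_col A) \<longleftrightarrow>
      (\<forall>i<dim_col A. \<forall>j<dim_col A. (mat_adjoint A * A) $$ (i,j) = 1\<^sub>m (dim_col A) $$ (i,j))"
    by (auto simp: mat_eq_iff)
  also have "\<dots> \<longleftrightarrow> orthonormal_cols A"
    unfolding orthonormal_cols_def by (auto simp: * simp del: index_mult_mat)
  finally show ?thesis by simp
qed

lemma orthonormal_cols_of_real:
  "orthonormal_cols A \<Longrightarrow> orthonormal_cols (map_mat complex_of_real A)"
  unfolding orthonormal_cols_def by (auto simp: scalar_prod_def simp flip: of_real_mult of_real_sum)

lemma orthonormal_cols_mult:
  fixes A B :: "complex mat"
  assumes A: "A \<in> carrier_mat m p" and B: "B \<in> carrier_mat p q"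
    and "orthonormal_cols A" "orthonormal_cols B"
  shows "orthonormal_cols (A * B)"
proof -
  have A': "mat_adjoint A \<in> carrier_mat p m" and B': "mat_adjoint B \<in> carrier_mat q p"
    using A B by auto
  have "mat_adjoint (A * B) * (A * B) = mat_adjoint B * (mat_adjoint A * A * B)"
    using A B A' B' by (simp add: mat_adjoint_mult[OF A B] assoc_mult_mat[of _ q p _ m _ q]
      assoc_mult_mat[of _ p m _ p _ q])
  also have "\<dots> = 1\<^sub>m q"
    using assms by (simp add: orthonormal_cols_iff)
  finally show ?thesis using B by (simp add: orthonormal_cols_iff)
qed

theorem proposition4p5:
  fixes k s :: nat
    and n r :: "nat \<Rightarrow> nat"
    and T :: "real tensor"
    and G :: "real cores"
    and Q1 R1 Q2 R2 :: "real mat"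
    and U V :: "index \<Rightarrow> complex mat"
    and S :: "index \<Rightarrow> real mat"
    and TU TS TV :: "complex tensor"
  assumes k: "k \<ge> 3"
    and n_pos: "\<forall>t\<in>{1..k}. n t > 0"
    and r_pos: "\<forall>t\<in>{0..k}. r t > 0"
    and r_ends: "r 0 = 1" "r k = 1"
    and T: "\<forall>j\<in>indices k n. T j = ttd k r G j"
    and r1: "r 1 \<le> n 1"
    and QR1: "thin_qr (matricize1 n r G) Q1 R1"
    and QR2: "thin_qr (matricize2 n r G) Q2 R2"
    and s: "s = Max ((\<lambda>\<beta>. mat_rank (M_mat k n r G R1 R2 \<beta>)) ` freqs k n)"
    and svd: "\<forall>\<beta>\<in>freqs k n. padded_compact_svd s (M_mat k n r G R1 R2 \<beta>) (U \<beta>) (S \<beta>) (V \<beta>)"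
    and TU: "TU = factor_tensor k n (map_mat complex_of_real Q1) U"
    and TS: "TS = factor_tensor k n (1\<^sub>m s) (\<lambda>\<beta>. map_mat complex_of_real (S \<beta>))"
    and TV: "TV = factor_tensor k n (map_mat complex_of_real Q2) V"
  shows "(\<forall>j\<in>indices k n. complex_of_real (T j) =
            hprod k n s (hprod k n s TU TS) (htranspose k n TV) j) \<and>
         (\<forall>\<beta>\<in>freqs k n.
            orthonormal_cols (face (n 1) s (fourier k n TU) \<beta>) \<and>
            orthonormal_cols (face (n 2) s (fourier k n TV) \<beta>) \<and>
            diagonal_mat (face s s (fourier k n TS) \<beta>) \<and>
            (\<forall>i<s. face s s (fourier k n TS) \<beta> $$ (i,i) \<in> \<real>\<^sub>\<ge>\<^sub>0))"
proof -
  let ?c = "map_mat complex_of_real"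
  have k2: "2 \<le> k" and npos: "\<forall>t\<in>{3..k}. n t > 0" using k n_pos by auto
  obtain q where Q1: "Q1 \<in> carrier_mat (n 1) (r 1)" and R1: "R1 \<in> carrier_mat (r 1) (r 1)"
    and o1: "orthonormal_cols Q1" and G1: "matricize1 n r G = Q1 * R1"
    and Q2: "Q2 \<in> carrier_mat (n 2) q" and R2: "R2 \<in> carrier_mat q (r 1 * r 2)"
    and o2: "orthonormal_cols Q2" and G2: "matricize2 n r G = Q2 * R2"
    using QR1 QR2 r1 by (auto simp: thin_qr_def Let_def matricize1_def matricize2_def min_absorb2)
  have M_dim: "M_mat k n r G R1 R2 \<beta> \<in> carrier_mat (r 1) q" for \<beta>
    using R1 R2 by (auto simp: M_mat_def B_mat_def)
  have svd': "U \<beta> \<in> carrier_mat (r 1) s" "S \<beta> \<in> carrier_mat s s" "V \<beta> \<in> carrier_mat q s"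
    "orthonormal_cols (U \<beta>)" "orthonormal_cols (V \<beta>)" "diagonal_mat (S \<beta>)"
    "\<And>i. i < s \<Longrightarrow> S \<beta> $$ (i,i) \<ge> 0"
    "M_mat k n r G R1 R2 \<beta> = U \<beta> * ?c (S \<beta>) * mat_adjoint (V \<beta>)" if \<beta>: "\<beta> \<in> freqs k n" for \<beta>
  proof -
    have dims: "dim_row (M_mat k n r G R1 R2 \<beta>) = r 1" "dim_col (M_mat k n r G R1 R2 \<beta>) = q"
      using M_dim[of \<beta>] by auto
    note p = svd[rule_format, OF \<beta>, unfolded padded_compact_svd_def dims]
    show "U \<beta> \<in> carrier_mat (r 1) s" "S \<beta> \<in> carrier_mat s s" "V \<beta> \<in> carrier_mat q s"
      "orthonormal_cols (U \<beta>)" "orthonormal_cols (V \<beta>)" "diagonal_mat (S \<beta>)"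
      "M_mat k n r G R1 R2 \<beta> = U \<beta> * ?c (S \<beta>) * mat_adjoint (V \<beta>)"
      using p by blast+
    show "S \<beta> $$ (i,i) \<ge> 0" if "i < s" for i
      using p that by (cases "i < mat_rank (M_mat k n r G R1 R2 \<beta>)") force+
  qed
  have FU: "face (n 1) s (fourier k n TU) \<beta> = ?c Q1 * U \<beta>"
    and FS: "face s s (fourier k n TS) \<beta> = ?c (S \<beta>)"
    and FV: "face (n 2) s (fourier k n TV) \<beta> = ?c Q2 * V \<beta>" if \<beta>: "\<beta> \<in> freqs k n" for \<beta>
  proof -
    show "face (n 1) s (fourier k n TU) \<beta> = ?c Q1 * U \<beta>"
      unfolding TU by (rule face_fourier_factor_tensor[OF k2 npos \<beta>]) (use Q1 svd'[OF \<beta>] in auto)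
    have "face s s (fourier k n TS) \<beta> = 1\<^sub>m s * ?c (S \<beta>)"
      unfolding TS by (rule face_fourier_factor_tensor[OF k2 npos \<beta>]) (use svd'[OF \<beta>] in auto)
    then show "face s s (fourier k n TS) \<beta> = ?c (S \<beta>)"
      using svd'(2)[OF \<beta>] by simp
    show "face (n 2) s (fourier k n TV) \<beta> = ?c Q2 * V \<beta>"
      unfolding TV by (rule face_fourier_factor_tensor[OF k2 npos \<beta>]) (use Q2 svd'[OF \<beta>] in auto)
  qed
  have "face (n 1) (n 2) (fourier k n (\<lambda>j. complex_of_real (ttd k r G j))) \<beta> =
      face (n 1) (n 2) (fourier k n (hprod k n s (hprod k n s TU TS) (htranspose k n TV))) \<beta>"
    if \<beta>: "\<beta> \<in> freqs k n" for \<beta>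
  proof -
    note c = Q1 Q2 R1 svd'(1-3)[OF \<beta>]
    have B: "B_mat k n r G R2 \<beta> \<in> carrier_mat (r 1) q" using R2 by (auto simp: B_mat_def)
    have Q2t: "mat_adjoint (?c Q2) = transpose_mat (?c Q2)" by (intro eq_matI) auto
    have V': "mat_adjoint (V \<beta>) \<in> carrier_mat s q" using c by auto
    have "face (n 1) (n 2) (fourier k n (\<lambda>j. complex_of_real (ttd k r G j))) \<beta> =
        ?c (Q1 * R1) * (B_mat k n r G R2 \<beta> * transpose_mat (?c Q2))"
      using face_fourier_ttd[OF k2 r_ends(1) G2 Q2 R2] G1 by simp
    also have "\<dots> = ?c Q1 * (M_mat k n r G R1 R2 \<beta> * transpose_mat (?c Q2))"
    proof -
      have "?c Q1 * ?c R1 * (B_mat k n r G R2 \<beta> * transpose_mat (?c Q2)) =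
          ?c Q1 * (?c R1 * (B_mat k n r G R2 \<beta> * transpose_mat (?c Q2)))"
        by (rule assoc_mult_mat[of _ "n 1" "r 1" _ "r 1" _ "n 2"]) (use c B in auto)
      also have "?c R1 * (B_mat k n r G R2 \<beta> * transpose_mat (?c Q2)) =
          ?c R1 * B_mat k n r G R2 \<beta> * transpose_mat (?c Q2)"
        by (rule assoc_mult_mat[symmetric, of _ "r 1" "r 1" _ q _ "n 2"]) (use c B in auto)
      finally show ?thesis unfolding M_mat_def of_real_hom.mat_hom_mult[OF Q1 R1] .
    qed
    also have "\<dots> = (?c Q1 * U \<beta>) * ?c (S \<beta>) * mat_adjoint (?c Q2 * V \<beta>)"
    proof -
      have "mat_adjoint (?c Q2 * V \<beta>) = mat_adjoint (V \<beta>) * transpose_mat (?c Q2)"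
        using c by (subst mat_adjoint_mult) (auto simp: Q2t)
      moreover have "U \<beta> * ?c (S \<beta>) * mat_adjoint (V \<beta>) * transpose_mat (?c Q2) =
          U \<beta> * ?c (S \<beta>) * (mat_adjoint (V \<beta>) * transpose_mat (?c Q2))"
        by (rule assoc_mult_mat[of _ "r 1" s _ q _ "n 2"]) (use c V' in auto)
      moreover have "?c Q1 * (U \<beta> * ?c (S \<beta>) * (mat_adjoint (V \<beta>) * transpose_mat (?c Q2))) =
          ?c Q1 * (U \<beta> * ?c (S \<beta>)) * (mat_adjoint (V \<beta>) * transpose_mat (?c Q2))"
        by (rule assoc_mult_mat[symmetric, of _ "n 1" "r 1" _ s _ "n 2"]) (use c V' in auto)
      moreover have "?c Q1 * (U \<beta> * ?c (S \<beta>)) = ?c Q1 * U \<beta> * ?c (S \<beta>)"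
        by (rule assoc_mult_mat[symmetric, of _ "n 1" "r 1" _ s _ s]) (use c in auto)
      ultimately show ?thesis
        unfolding svd'(8)[OF \<beta>] by (simp only:)
    qed
    finally show ?thesis
      by (simp only: face_fourier_hprod[OF npos \<beta>] face_fourier_htranspose[OF npos \<beta>]
        FU[OF \<beta>] FS[OF \<beta>] FV[OF \<beta>])
  qed
  then have product: "complex_of_real (ttd k r G j) =
      hprod k n s (hprod k n s TU TS) (htranspose k n TV) j" if "j \<in> indices k n" for j
    using tensor_eqI_fourier_faces[OF npos k2 _ that] by blast
  have factors: "orthonormal_cols (?c Q1 * U \<beta>)" "orthonormal_cols (?c Q2 * V \<beta>)"
    "diagonal_mat (?c (S \<beta>))" "\<And>i. i < s \<Longrightarrow> ?c (S \<beta>) $$ (i,i) \<in> \<real>\<^sub>\<ge>\<^sub>0" if \<beta>: "\<beta> \<in> freqs k n" for \<beta>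
  proof -
    note v = svd'[OF \<beta>]
    show "orthonormal_cols (?c Q1 * U \<beta>)"
      using v Q1 by (intro orthonormal_cols_mult[of _ "n 1" "r 1" _ s] orthonormal_cols_of_real o1) auto
    show "orthonormal_cols (?c Q2 * V \<beta>)"
      using v Q2 by (intro orthonormal_cols_mult[of _ "n 2" q _ s] orthonormal_cols_of_real o2) auto
    show "diagonal_mat (?c (S \<beta>))" using v by (auto simp: diagonal_mat_def)
    show "?c (S \<beta>) $$ (i,i) \<in> \<real>\<^sub>\<ge>\<^sub>0" if "i < s" for i using v that by simp
  qed
  show ?thesis
    by (intro conjI ballI allI impI)
      (simp_all only: T[rule_format] product FU FS FV factors)
qed

end
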